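(* Let $r>0$ and let $G^*$ be a geometric graph in $(\mathbb{R}^d,\|\cdot\|)$ with vertex set $V\subseteq\mathbb{R}^d$ (two vertices adjacent iff their distance is at most $r$). Then there exists a well-separated clique-partitions family $\mathcal{P}=\{P_i\}_{i\in\Lambda}$ of $G^*$ with $|\Lambda|\le\beta^2$, where $\beta=\beta(d)$ is the Besicovitch constant of $\mathbb{R}^d$.
   Context: $\|\cdot\|$ is an arbitrary norm on $\mathbb{R}^d$, and $B_s(x)=\{y:\|y-x\|\le s\}$. Besicovitch constant: a $\delta$-packing with respect to $P\subseteq\mathbb{R}^d$ is a countable collection of pairwise disjoint closed balls of radius $\delta$ centered at points of $P$; the Besicovitch constant $\beta=\beta(d)\in\mathbb{N}$ is a constant such that for every $P\subseteq\mathbb{R}^d$ and $\delta>0$ there are $\beta$ $\delta$-packings with respect to $P$ whose union covers $P$. Well-separated clique-partitions family: a family $\mathcal{P}=\{P_i\}_{i\in\Lambda}$ of subsets $P_i\subseteq V$ such that (1) $V=\bigcup_{i\in\Lambda}P_i$, and (2) for each $i\in\Lambda$, $P_i$ can be partitioned as $P_i=C^{(i)}_1\sqcup\cdots\sqcup C^{(i)}_{m_i}$ where (2-a) for each $j$ there is $\bar v^{(i)}_j\in V$ with $C^{(i)}_j\subseteq B_{r/2}(\bar v^{(i)}_j)\cap V$, and (2-b) for $j_1\ne j_2$, $d_H(C^{(i)}_{j_1},C^{(i)}_{j_2})>r$, where $d_H$ is the Hausdorff distance with respect to $\|\cdot\|$.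
   Formalization: For unbounded V each P_i may be a countable disjoint union of cells C_j instead of a finite one (finitely many bounded cells cannot cover an unbounded V, so the literal claim fails there); for bounded V the number m_i of cells is finite as stated. *)

theory Defs
  imports "HOL-Analysis.Analysis"
begin

definition is_norm :: "(real ^ 'n \<Rightarrow> real) \<Rightarrow> bool" where
  "is_norm N \<longleftrightarrow>
     (\<forall>x. 0 \<le> N x) \<and> (\<forall>x. N x = 0 \<longleftrightarrow> x = 0) \<and>
     (\<forall>c x. N (c *\<^sub>R x) = \<bar>c\<bar> * N x) \<and> (\<forall>x y. N (x + y) \<le> N x + N y)"

definition norm_ball :: "(real ^ 'n \<Rightarrow> real) \<Rightarrow> real \<Rightarrow> real ^ 'n \<Rightarrow> (real ^ 'n) set" where
  "norm_ball N s x = {y. N (y - x) \<le> s}"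

(* Extended values avoid the arbitrary real Sup and Inf of unbounded or empty sets. *)
definition hausdorff_distance ::
    "(real ^ 'n \<Rightarrow> real) \<Rightarrow> (real ^ 'n) set \<Rightarrow> (real ^ 'n) set \<Rightarrow> ennreal" where
  "hausdorff_distance N A B =
     max (SUP a\<in>A. INF b\<in>B. ennreal (N (a - b))) (SUP b\<in>B. INF a\<in>A. ennreal (N (a - b)))"

definition ball_packing ::
    "(real ^ 'n \<Rightarrow> real) \<Rightarrow> real \<Rightarrow> (real ^ 'n) set \<Rightarrow> (real ^ 'n) set set \<Rightarrow> bool" where
  "ball_packing N \<delta> P F \<longleftrightarrow>
     countable F \<and> F \<subseteq> norm_ball N \<delta> ` P \<and> disjoint F"

(* Not required to be the least such number: any number with the covering property qualifies. *)
definition besicovitch_constant :: "(real ^ 'n \<Rightarrow> real) \<Rightarrow> nat \<Rightarrow> bool" where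
  "besicovitch_constant N \<beta> \<longleftrightarrow>
     (\<forall>P \<delta>. \<delta> > 0 \<longrightarrow>
        (\<exists>F :: nat \<Rightarrow> (real ^ 'n) set set.
           (\<forall>k<\<beta>. ball_packing N \<delta> P (F k)) \<and> P \<subseteq> (\<Union>k<\<beta>. \<Union>(F k))))"

record 'a ugraph =
  verts :: "'a set"
  edges :: "'a set set"

definition geometric_graph ::
    "(real ^ 'n \<Rightarrow> real) \<Rightarrow> real \<Rightarrow> (real ^ 'n) set \<Rightarrow> (real ^ 'n) ugraph" where
  "geometric_graph N r V =
     \<lparr>verts = V, edges = {{u, v} | u v. u \<in> V \<and> v \<in> V \<and> u \<noteq> v \<and> N (u - v) \<le> r}\<rparr>"

(* The blocks C_1, ..., C_m of a part form a set of nonempty blocks, finite as soon as the vertex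
   set is bounded (in particular when it is finite).  For an unbounded vertex set, finitely many
   bounded blocks in each of finitely many parts cannot cover it, so a countable sequence of
   blocks is allowed in that case. *)
definition well_separated_clique_partition ::
    "(real ^ 'n \<Rightarrow> real) \<Rightarrow> real \<Rightarrow> (real ^ 'n) ugraph \<Rightarrow> (real ^ 'n) set
      \<Rightarrow> (real ^ 'n) set set \<Rightarrow> bool" where
  "well_separated_clique_partition N r G Q \<C> \<longleftrightarrow>
     partition_on Q \<C> \<and>
     countable \<C> \<and> (bounded (verts G) \<longrightarrow> finite \<C>) \<and>
     (\<forall>C\<in>\<C>. \<exists>v\<in>verts G. C \<subseteq> norm_ball N (r / 2) v \<inter> verts G) \<and>
     (\<forall>C\<in>\<C>. \<forall>D\<in>\<C>. C \<noteq> D \<longrightarrow> hausdorff_distance N C D > ennreal r)"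

definition well_separated_clique_partitions_family ::
    "(real ^ 'n \<Rightarrow> real) \<Rightarrow> real \<Rightarrow> (real ^ 'n) ugraph \<Rightarrow> 'i set
      \<Rightarrow> ('i \<Rightarrow> (real ^ 'n) set) \<Rightarrow> bool" where
  "well_separated_clique_partitions_family N r G \<Lambda> P \<longleftrightarrow>
     (\<forall>i\<in>\<Lambda>. P i \<subseteq> verts G) \<and>
     verts G = (\<Union>i\<in>\<Lambda>. P i) \<and>
     (\<forall>i\<in>\<Lambda>. \<exists>\<C>. well_separated_clique_partition N r G (P i) \<C>)"

end

theory Submission
  imports Defs
begin

text \<open>Cover \<open>V\<close> by \<open>\<beta>\<close> packings of balls of radius \<open>r/2\<close>; within one packing the centers are more
  than \<open>r\<close> apart. Apply the Besicovitch property once more, with radius \<open>r\<close>, to the centers of each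
  packing: a center in the ball of radius \<open>r\<close> around another one would be too close to it, so the
  \<open>\<beta>\<close> new packings together have all old centers as their centers. This splits each
  packing into \<open>\<beta>\<close> subfamilies with centers more than \<open>2r\<close> apart, whose balls of radius \<open>r/2\<close> are at
  distance more than \<open>r\<close> from each other.\<close>

text \<open>The inequality is strict because balls are closed: a point of an
  \<open>s\<close>-separated set is then the only one in its own closed ball of radius
  \<open>s\<close>.\<close>

definition separated :: "(real ^ 'n \<Rightarrow> real) \<Rightarrow> real \<Rightarrow> (real ^ 'n) set \<Rightarrow> bool" where
  "separated N s Q \<longleftrightarrow> (\<forall>x\<in>Q. \<forall>y\<in>Q. x \<noteq> y \<longrightarrow> s < N (x - y))"

lemma is_norm_zero: "is_norm N \<Longrightarrow> N 0 = 0"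
  by (simp add: is_norm_def)

lemma is_norm_nonneg: "is_norm N \<Longrightarrow> 0 \<le> N x"
  by (simp add: is_norm_def)

lemma is_norm_scaleR: "is_norm N \<Longrightarrow> N (c *\<^sub>R x) = \<bar>c\<bar> * N x"
  by (simp add: is_norm_def)

lemma is_norm_triangle: "is_norm N \<Longrightarrow> N (x + y) \<le> N x + N y"
  by (simp add: is_norm_def)

lemma is_norm_minus_commute:
  assumes "is_norm N"
  shows "N (x - y) = N (y - x)"
  using is_norm_scaleR[OF assms, of "-1" "x - y"] by simp

lemma is_norm_diff_triangle:
  assumes "is_norm N"
  shows "N (x - z) \<le> N (x - y) + N (y - z)"
  using is_norm_triangle[OF assms, of "x - y" "y - z"] by simp

lemma is_norm_sum_le:
  assumes "is_norm N"
  shows "N (\<Sum>i\<in>A. f i) \<le> (\<Sum>i\<in>A. N (f i))"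
proof (induction A rule: infinite_finite_induct)
  case (insert a A)
  then show ?case
    using is_norm_triangle[OF assms, of "f a" "sum f A"] by simp
qed (simp_all add: is_norm_zero[OF assms])

text \<open>Expansion in the standard basis gives this half of the equivalence of norms, which turns
  separation in \<open>N\<close> into Euclidean separation.\<close>

lemma is_norm_le_norm:
  assumes "is_norm N"
  obtains C where "C > 0" "\<And>x. N x \<le> C * norm x"
proof
  define C where "C = 1 + (\<Sum>b\<in>Basis. N b)"
  show "C > 0"
    unfolding C_def using sum_nonneg[of Basis N] is_norm_nonneg[OF assms] by (smt (verit))
  show "N x \<le> C * norm x" for x
  proof -
    have "N x = N (\<Sum>b\<in>Basis. (x \<bullet> b) *\<^sub>R b)"
      by (simp add: euclidean_representation)
    also have "\<dots> \<le> (\<Sum>b\<in>Basis. \<bar>x \<bullet> b\<bar> * N b)"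
      using is_norm_sum_le[OF assms, of "\<lambda>b. (x \<bullet> b) *\<^sub>R b" Basis]
      by (simp add: is_norm_scaleR[OF assms])
    also have "\<dots> \<le> (\<Sum>b\<in>Basis. norm x * N b)"
      by (intro sum_mono mult_right_mono Basis_le_norm is_norm_nonneg[OF assms])
    also have "\<dots> \<le> C * norm x"
      unfolding C_def sum_distrib_left[symmetric] by (simp add: algebra_simps)
    finally show ?thesis .
  qed
qed

text \<open>If the centers were within \<open>2 * \<delta>\<close>, their midpoint would lie in both
  balls.\<close>

lemma disjoint_balls_imp_far:
  assumes "is_norm N" and "norm_ball N \<delta> x \<inter> norm_ball N \<delta> y = {}"
  shows "2 * \<delta> < N (x - y)"
proof (rule ccontr)
  assume far: "\<not> 2 * \<delta> < N (x - y)"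
  define m where "m = (1/2) *\<^sub>R (x + y)"
  have "m - x = (1/2) *\<^sub>R (y - x)" "m - y = (1/2) *\<^sub>R (x - y)"
    by (simp_all add: m_def vec_eq_iff field_simps)
  then have "N (m - x) \<le> \<delta>" "N (m - y) \<le> \<delta>"
    using far is_norm_minus_commute[OF assms(1), of x y]
    by (simp_all add: is_norm_scaleR[OF assms(1)])
  then show False
    using assms(2) by (auto simp: norm_ball_def)
qed

text \<open>Distinct points of \<open>Q\<close> have Euclidean distance at least
  \<open>s / C\<close>, so \<open>Q\<close> is compact without limit points. This supplies the
  finiteness of the blocks when the vertex set is bounded.\<close>

lemma bounded_separated_imp_finite:
  assumes "is_norm N" "separated N s Q" "bounded Q" "s > 0"
  shows "finite Q"
proof -
  obtain C where C: "C > 0" "\<And>x. N x \<le> C * norm x"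
    using is_norm_le_norm[OF assms(1)] by blast
  have "x = y" if "x \<in> Q" "y \<in> Q" "dist y x < s / C" for x y
  proof (rule ccontr)
    assume "x \<noteq> y"
    then have "s < C * norm (y - x)"
      using that assms(2) C(2)[of "y - x"] unfolding separated_def by fastforce
    then show False
      using that(3) C(1) by (simp add: dist_norm pos_less_divide_eq mult.commute)
  qed
  then have sep: "y = x" if "x \<in> Q" "y \<in> Q" "dist y x < s / C" for x y
    using that by blast
  have pos: "s / C > 0"
    using C assms(4) by simp
  have "closed Q"
    by (rule discrete_imp_closed[OF pos]) (use sep in blast)
  then have cpt: "compact Q"
    using assms(3) by (simp add: compact_eq_bounded_closed)
  show ?thesis
  proof (rule ccontr)
    assume "infinite Q"
    with cpt obtain x where "x \<in> Q" "x islimpt Q"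
      by (meson compact_eq_Bolzano_Weierstrass subset_refl)
    with pos obtain y where "y \<in> Q" "y \<noteq> x" "dist y x < s / C"
      unfolding islimpt_approachable by blast
    with sep \<open>x \<in> Q\<close> show False by blast
  qed
qed

text \<open>The Besicovitch property is restated for sets of centers, the form in which it can be
  applied a second time.\<close>

lemma besicovitch_centers:
  assumes N: "is_norm N" and "besicovitch_constant N \<beta>" and "\<delta> > 0"
  shows "\<exists>Q :: nat \<Rightarrow> (real ^ 'n) set.
    (\<forall>k<\<beta>. countable (Q k) \<and> Q k \<subseteq> P \<and> separated N (2 * \<delta>) (Q k)) \<and>
    P \<subseteq> (\<Union>k<\<beta>. \<Union>q\<in>Q k. norm_ball N \<delta> q)"
proof -
  obtain F where F: "\<forall>k<\<beta>. ball_packing N \<delta> P (F k)" and cover: "P \<subseteq> (\<Union>k<\<beta>. \<Union>(F k))"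
    using assms(2,3) unfolding besicovitch_constant_def by blast
  have "\<forall>k. \<exists>Q. k < \<beta> \<longrightarrow> countable Q \<and> Q \<subseteq> P \<and> separated N (2 * \<delta>) Q \<and>
      \<Union>(F k) \<subseteq> (\<Union>q\<in>Q. norm_ball N \<delta> q)"
  proof
    fix k
    show "\<exists>Q. k < \<beta> \<longrightarrow> countable Q \<and> Q \<subseteq> P \<and> separated N (2 * \<delta>) Q \<and>
      \<Union>(F k) \<subseteq> (\<Union>q\<in>Q. norm_ball N \<delta> q)"
    proof (cases "k < \<beta>")
      case True
      then have cnt: "countable (F k)" and sub: "F k \<subseteq> norm_ball N \<delta> ` P" and dis: "disjoint (F k)"
        using F by (auto simp: ball_packing_def)
      \<comment> \<open>A packing is a set of balls and does not record centers, so one center in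
        \<open>P\<close> is chosen for each ball.\<close>
      define c where "c = inv_into P (norm_ball N \<delta>)"
      have c: "c B \<in> P" "norm_ball N \<delta> (c B) = B" if "B \<in> F k" for B
        using that sub by (auto simp: c_def inv_into_into f_inv_into_f)
      have "separated N (2 * \<delta>) (c ` F k)"
        unfolding separated_def
      proof (intro ballI impI)
        fix x y assume "x \<in> c ` F k" "y \<in> c ` F k" "x \<noteq> y"
        then obtain A B where "A \<in> F k" "B \<in> F k" "A \<noteq> B" "x = c A" "y = c B"
          by blast
        then have "norm_ball N \<delta> x \<inter> norm_ball N \<delta> y = {}"
          using dis c by (simp add: disjointD)
        then show "2 * \<delta> < N (x - y)"
          by (rule disjoint_balls_imp_far[OF N])
      qed
      moreover have "\<Union>(F k) \<subseteq> (\<Union>q\<in>c ` F k. norm_ball N \<delta> q)"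
        using c by auto
      ultimately show ?thesis
        using cnt c(1) by (intro exI[of _ "c ` F k"]) auto
    qed simp
  qed
  then obtain Q where Q: "\<forall>k<\<beta>. countable (Q k) \<and> Q k \<subseteq> P \<and> separated N (2 * \<delta>) (Q k) \<and>
      \<Union>(F k) \<subseteq> (\<Union>q\<in>Q k. norm_ball N \<delta> q)"
    by metis
  have "P \<subseteq> (\<Union>k<\<beta>. \<Union>q\<in>Q k. norm_ball N \<delta> q)"
    by (rule order_trans[OF cover], rule UN_mono) (use Q in auto)
  with Q show ?thesis
    by (intro exI[of _ Q]) simp
qed

text \<open>Centers are more than \<open>2 * r\<close> apart and each of two balls takes up at most
  \<open>r / 2\<close> of that distance, which leaves more than \<open>r\<close> between
  them.\<close>

lemma well_separated_clique_partition_balls: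
  assumes N: "is_norm N" and "r > 0" and Q: "countable Q" "Q \<subseteq> verts G" "separated N (2 * r) Q"
  shows "well_separated_clique_partition N r G (\<Union>q\<in>Q. norm_ball N (r / 2) q \<inter> verts G)
    ((\<lambda>q. norm_ball N (r / 2) q \<inter> verts G) ` Q)"
proof -
  let ?C = "\<lambda>q. norm_ball N (r / 2) q \<inter> verts G"
  \<comment> \<open>Go from \<open>q\<close> to \<open>q'\<close> through \<open>a\<close> and
    \<open>b\<close>; the first and last legs cost at most \<open>r / 2\<close> each.\<close>
  have gap: "N (q - q') - r \<le> N (a - b)" if "a \<in> ?C q" "b \<in> ?C q'" for q q' a b
    using that is_norm_diff_triangle[OF N, of q q' a] is_norm_diff_triangle[OF N, of a q' b]
      is_norm_minus_commute[OF N, of q a]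
    by (auto simp: norm_ball_def)
  have center: "q \<in> ?C q" if "q \<in> Q" for q
    using that Q(2) \<open>r > 0\<close> is_norm_zero[OF N] by (auto simp: norm_ball_def)
  have disj: "?C q \<inter> ?C q' = {}" if "q \<in> Q" "q' \<in> Q" "q \<noteq> q'" for q q'
  proof (rule ccontr)
    assume "?C q \<inter> ?C q' \<noteq> {}"
    then obtain a where "a \<in> ?C q" "a \<in> ?C q'" by blast
    \<comment> \<open>A common point serves as both \<open>a\<close> and \<open>b\<close> in
      \<open>gap\<close>.\<close>
    then have "N (q - q') - r \<le> 0"
      using gap[of a q a q'] is_norm_zero[OF N] by simp
    then show False
      using that Q(3) \<open>r > 0\<close> unfolding separated_def by fastforce
  qed
  have "partition_on (\<Union>q\<in>Q. ?C q) (?C ` Q)"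
  proof (rule partition_onI)
    show "disjnt p p'" if "p \<in> ?C ` Q" "p' \<in> ?C ` Q" "p \<noteq> p'" for p p'
      using that disj unfolding disjnt_def by blast
  qed (use center in auto)
  moreover have "finite (?C ` Q)" if "bounded (verts G)"
    using bounded_separated_imp_finite[OF N Q(3)] bounded_subset[OF that Q(2)] \<open>r > 0\<close> by simp
  moreover have "hausdorff_distance N (?C q) (?C q') > ennreal r"
    if "q \<in> Q" "q' \<in> Q" "?C q \<noteq> ?C q'" for q q'
  proof -
    have "r < N (q - q') - r"
      using that Q(3) unfolding separated_def by fastforce
    then have "ennreal r < ennreal (N (q - q') - r)"
      using \<open>r > 0\<close> by (simp add: ennreal_less_iff)
    \<comment> \<open>One point of the first block bounds the supremum from below; the center
      \<open>q\<close> is a convenient choice.\<close>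
    also have "\<dots> \<le> (INF b\<in>?C q'. ennreal (N (q - b)))"
      by (intro INF_greatest ennreal_leI gap center that)
    also have "\<dots> \<le> (SUP a\<in>?C q. INF b\<in>?C q'. ennreal (N (a - b)))"
      by (rule SUP_upper[OF center[OF that(1)]])
    also have "\<dots> \<le> hausdorff_distance N (?C q) (?C q')"
      unfolding hausdorff_distance_def by (rule max.cobounded1)
    finally show ?thesis .
  qed
  ultimately show ?thesis
    unfolding well_separated_clique_partition_def using Q(1,2) by auto
qed

theorem theorem2p7:
  fixes N :: "real ^ 'n \<Rightarrow> real" and r :: real and V :: "(real ^ 'n) set" and \<beta> :: nat
  assumes "is_norm N"
    and "besicovitch_constant N \<beta>"
    and "r > 0"
  shows "\<exists>(\<Lambda> :: nat set) P.
           well_separated_clique_partitions_family N r (geometric_graph N r V) \<Lambda> P \<and>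
           finite \<Lambda> \<and> card \<Lambda> \<le> \<beta>\<^sup>2"
proof -
  obtain Q where Q: "\<forall>k<\<beta>. countable (Q k) \<and> Q k \<subseteq> V \<and> separated N r (Q k)"
    and cover: "V \<subseteq> (\<Union>k<\<beta>. \<Union>q\<in>Q k. norm_ball N (r / 2) q)"
    using besicovitch_centers[OF assms(1,2), of "r / 2" V] assms(3) by auto
  \<comment> \<open>The second application takes \<open>Q k\<close> as the set to cover and radius
    \<open>r\<close>, which doubles to the separation \<open>2 * r\<close>.\<close>
  have "\<forall>k. \<exists>R. (\<forall>j<\<beta>. countable (R j) \<and> R j \<subseteq> Q k \<and> separated N (2 * r) (R j)) \<and>
      Q k \<subseteq> (\<Union>j<\<beta>. \<Union>q\<in>R j. norm_ball N r q)"
    by (intro allI besicovitch_centers[OF assms])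
  then obtain R where R: "\<And>k j. j < \<beta> \<Longrightarrow> countable (R k j) \<and> R k j \<subseteq> Q k \<and> separated N (2 * r) (R k j)"
    and covR: "\<And>k. Q k \<subseteq> (\<Union>j<\<beta>. \<Union>q\<in>R k j. norm_ball N r q)"
    by metis
  have QR: "\<exists>j<\<beta>. q \<in> R k j" if k: "k < \<beta>" and q: "q \<in> Q k" for k q
  proof -
    obtain j q' where j: "j < \<beta>" "q' \<in> R k j" "q \<in> norm_ball N r q'"
      using subsetD[OF covR q] by blast
    then have "N (q - q') \<le> r" "q' \<in> Q k"
      using R[of j k] by (auto simp: norm_ball_def)
    \<comment> \<open>Both points lie in \<open>Q k\<close>, which is \<open>r\<close>-separated, so
      being covered by a ball means being its center.\<close>
    then have "q = q'"
      using Q k q unfolding separated_def by (meson linorder_not_le)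
    with j show ?thesis by blast
  qed
  let ?G = "geometric_graph N r V"
  have verts: "verts ?G = V"
    by (simp add: geometric_graph_def)
  \<comment> \<open>The pair \<open>(k, j)\<close> is encoded in base \<beta> as
    \<open>k * \<beta> + j\<close>, so that the index set is the numbers below
    \<open>\<beta>\<^sup>2\<close>.\<close>
  define P where "P i = (\<Union>q\<in>R (i div \<beta>) (i mod \<beta>). norm_ball N (r / 2) q \<inter> V)" for i
  have digits: "i div \<beta> < \<beta>" "i mod \<beta> < \<beta>" if "i < \<beta>\<^sup>2" for i
  proof -
    show "i div \<beta> < \<beta>"
      using that by (simp add: power2_eq_square less_mult_imp_div_less)
    \<comment> \<open>The bound on the quotient forces \<beta> to be positive, which the bound on
      the remainder requires.\<close>
    then show "i mod \<beta> < \<beta>" by simp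
  qed
  have "V \<subseteq> (\<Union>i<\<beta>\<^sup>2. P i)"
  proof
    fix x assume "x \<in> V"
    then obtain k q where k: "k < \<beta>" "q \<in> Q k" "x \<in> norm_ball N (r / 2) q"
      using cover by blast
    then obtain j where j: "j < \<beta>" "q \<in> R k j"
      using QR by blast
    define i where "i = k * \<beta> + j"
    have "i div \<beta> = k" "i mod \<beta> = j"
      using j(1) by (simp_all add: i_def)
    moreover have "i < \<beta>\<^sup>2"
    proof -
      have "i < Suc k * \<beta>" using j(1) by (simp add: i_def)
      also have "\<dots> \<le> \<beta> * \<beta>" using k(1) by (intro mult_right_mono) auto
      finally show ?thesis by (simp add: power2_eq_square)
    qed
    ultimately show "x \<in> (\<Union>i<\<beta>\<^sup>2. P i)"
      using j(2) k(3) \<open>x \<in> V\<close> by (auto simp: P_def)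
  qed
  moreover have "P i \<subseteq> V" for i
    by (auto simp: P_def)
  moreover have "\<exists>\<C>. well_separated_clique_partition N r ?G (P i) \<C>" if "i < \<beta>\<^sup>2" for i
  proof -
    have "countable (R (i div \<beta>) (i mod \<beta>))" "R (i div \<beta>) (i mod \<beta>) \<subseteq> verts ?G"
      "separated N (2 * r) (R (i div \<beta>) (i mod \<beta>))"
      using R[OF digits(2)[OF that]] Q digits(1)[OF that] unfolding verts by blast+
    from well_separated_clique_partition_balls[OF assms(1,3) this] show ?thesis
      unfolding P_def verts by blast
  qed
  ultimately have "well_separated_clique_partitions_family N r ?G {..<\<beta>\<^sup>2} P"
    unfolding well_separated_clique_partitions_family_def verts by blast
  then show ?thesis
    by (intro exI[of _ "{..<\<beta>\<^sup>2}"] exI[of _ P]) simp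
qed

end
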